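(* For $n\ge1$ write $P_n(X)=\sum_{i\ge1}a_{i,n}H_i(X)$. For $1\le i\le n$, the coefficients $a_{i,n}$ can be computed by induction on $i$ by $$a_{i,n}=\begin{cases}\delta_{n,1}&\text{if }i=1,\\ \displaystyle\sum_{k=1}^{\lfloor\frac{n+1}{2}\rfloor}\binom{n-k+1}{k}a_{i-1,n-k}&\text{if }i\ge2,\end{cases}$$ where $\delta_{n,1}$ is the Kronecker symbol.
   Context: $H_i(X)=X(X-1)\cdots(X-i+1)/i!$ is the $i$-th Hilbert polynomial ($H_0=1$), over a field $\mathbb{K}$ of characteristic zero. The polynomials $P_n\in\mathbb{K}[X]$, $n\ge0$, are $P_n=\phi_{\mathcal{NCP}}(J_n)$ for $n\ge1$, where $J_n=\{\{1\},\ldots,\{n\}\}$ is the noncrossing partition of $\{1,\ldots,n\}$ into singletons and $\phi_{\mathcal{NCP}}$ is the fundamental polynomial invariant of noncrossing partitions, and $P_0=1$. Equivalently, $(P_n)_{n\ge0}$ is the unique sequence of polynomials such that $P_0(X)=1$ and, for all $k\ge1$, $P_k(0)=0$ and $P_k(X+1)=P_k(X)+\sum_{i=1}^kP_{i-1}(X)P_{k-i}(X)$. Also equivalently, for $n,N\ge1$, $P_n(N)$ is the number of maps $c:\{1,\ldots,n\}\to\{1,\ldots,N\}$ such that whenever $p<r$ and $c(p)=c(r)$ there is $q$ with $p<q<r$ and $c(q)<c(p)$; thus $a_{i,n}$ is the number of such maps that are surjective onto $\{1,\ldots,i\}$. The coefficients $a_{i,n}$ are defined for all $i,n\ge1$ (the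 $H_i$ form a basis of $\mathbb{K}[X]$). *)

theory Defs
  imports "HOL-Computational_Algebra.Polynomial"
begin

text \<open>Hilbert polynomials \<open>H\<^sub>i(X) = X(X-1)\<dots>(X-i+1)/i!\<close>.\<close>

definition hilbert_poly :: "nat \<Rightarrow> 'a::field_char_0 poly" where
  "hilbert_poly i = smult (1 / fact i) (\<Prod>j<i. [:- of_nat j, 1:])"

text \<open>\<open>P\<^sub>n\<close> is the value of the fundamental polynomial invariant of noncrossing partitions on
  the partition of \<open>{1,\<dots>,n}\<close> into singletons (with \<open>P\<^sub>0 = 1\<close>). It is introduced
  through its characterization as the unique sequence of polynomials satisfying the following
  conditions; \<open>pcompose p [:1, 1:]\<close> is \<open>p(X+1)\<close>.\<close>

definition is_ncp_sequence :: "(nat \<Rightarrow> 'a::field_char_0 poly) \<Rightarrow> bool" where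
  "is_ncp_sequence P \<longleftrightarrow>
     P 0 = 1 \<and>
     (\<forall>k\<ge>1. poly (P k) 0 = 0 \<and>
            pcompose (P k) [:1, 1:] = P k + (\<Sum>i=1..k. P (i - 1) * P (k - i)))"

definition ncp_poly :: "nat \<Rightarrow> 'a::field_char_0 poly" where
  "ncp_poly = (THE P. is_ncp_sequence P)"

text \<open>Coefficients with respect to the Hilbert basis: \<open>p = \<Sum>\<^sub>i\<^sub>\<ge>\<^sub>1 c\<^sub>i H\<^sub>i\<close>,
  where all but finitely many \<open>c\<^sub>i\<close> vanish.\<close>

definition hilbert_expansion :: "'a::field_char_0 poly \<Rightarrow> (nat \<Rightarrow> 'a) \<Rightarrow> bool" where
  "hilbert_expansion p c \<longleftrightarrow>
     finite {i. 1 \<le> i \<and> c i \<noteq> 0} \<and>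
     p = (\<Sum>i | 1 \<le> i \<and> c i \<noteq> 0. smult (c i) (hilbert_poly i))"

text \<open>The remaining facts show that the above notions are well defined: the sequence
  \<open>ncp_poly\<close> exists and is unique, and each \<open>ncp_poly n\<close> with \<open>n \<ge> 1\<close> has a unique
  expansion.\<close>

lemma hilbert_poly_0: "hilbert_poly 0 = 1"
  by (simp add: hilbert_poly_def)

lemma poly_hilbert_poly: "poly (hilbert_poly i) x = x gchoose i"
  by (simp add: hilbert_poly_def poly_prod gbinomial_prod_rev lessThan_atLeast0)

lemma degree_hilbert_poly: "degree (hilbert_poly i :: 'a::field_char_0 poly) = i"
proof -
  have "degree (\<Prod>j<i. [:- of_nat j, 1::'a:]) = (\<Sum>j<i. degree [:- of_nat j, 1::'a:])"
    by (rule degree_prod_eq_sum_degree) auto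
  then show ?thesis by (simp add: hilbert_poly_def)
qed

lemma hilbert_poly_shift:
  "pcompose (hilbert_poly (Suc i)) [:1, 1:] = hilbert_poly (Suc i) + (hilbert_poly i :: 'a::field_char_0 poly)"
proof -
  have "poly (pcompose (hilbert_poly (Suc i)) [:1, 1:]) x
      = poly (hilbert_poly (Suc i) + (hilbert_poly i :: 'a poly)) x" for x
    by (simp add: poly_pcompose poly_hilbert_poly add.commute[of 1] gbinomial_Suc_Suc)
  then show ?thesis using poly_eq_poly_eq_iff by blast
qed

lemma hilbert_span:
  fixes p :: "'a::field_char_0 poly"
  shows "degree p \<le> n \<Longrightarrow> \<exists>c. p = (\<Sum>i\<le>n. smult (c i) (hilbert_poly i))"
proof (induction n arbitrary: p)
  case 0
  then obtain b where "p = [:b:]" by (auto elim: degree_eq_zeroE)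
  then have "p = (\<Sum>i\<le>0. smult b (hilbert_poly i))" by (simp add: hilbert_poly_0)
  then show ?case by (rule exI[of _ "\<lambda>_. b"])
next
  case (Suc n)
  let ?H = "hilbert_poly (Suc n) :: 'a poly"
  have nz: "coeff ?H (Suc n) \<noteq> 0"
    using degree_hilbert_poly[of "Suc n", where ?'a='a] by (metis coeff_0 degree_0 leading_coeff_0_iff nat.distinct(1))
  define b where "b = coeff p (Suc n) / coeff ?H (Suc n)"
  let ?q = "p - smult b ?H"
  have "degree ?q \<le> n"
  proof (rule degree_le, intro allI impI)
    fix i assume "n < i"
    show "coeff ?q i = 0"
    proof (cases "i = Suc n")
      case True then show ?thesis using nz by (simp add: b_def)
    next
      case False
      with \<open>n < i\<close> Suc.prems have "coeff p i = 0" "coeff ?H i = 0"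
        by (auto intro!: coeff_eq_0 simp: degree_hilbert_poly)
      then show ?thesis by simp
    qed
  qed
  then obtain c where c: "?q = (\<Sum>i\<le>n. smult (c i) (hilbert_poly i))" using Suc.IH by blast
  have "(\<Sum>i\<le>Suc n. smult ((c(Suc n := b)) i) (hilbert_poly i))
      = (\<Sum>i\<le>n. smult (c i) (hilbert_poly i)) + smult b ?H"
    by (auto intro!: sum.cong)
  with c have "p = (\<Sum>i\<le>Suc n. smult ((c(Suc n := b)) i) (hilbert_poly i))" by (metis diff_add_cancel)
  then show ?case by blast
qed

lemma hilbert_independent:
  fixes c :: "nat \<Rightarrow> 'a::field_char_0"
  assumes "(\<Sum>i\<le>n. smult (c i) (hilbert_poly i)) = 0" "i \<le> n"
  shows "c i = 0"
  using assms
proof (induction n arbitrary: i)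
  case 0 then show ?case by (simp add: hilbert_poly_0)
next
  case (Suc n)
  let ?H = "hilbert_poly (Suc n) :: 'a poly"
  have nz: "coeff ?H (Suc n) \<noteq> 0"
    using degree_hilbert_poly[of "Suc n", where ?'a='a] by (metis coeff_0 degree_0 leading_coeff_0_iff nat.distinct(1))
  have "coeff (\<Sum>i\<le>n. smult (c i) (hilbert_poly i)) (Suc n) = 0"
    by (auto simp: coeff_sum degree_hilbert_poly intro!: sum.neutral coeff_eq_0)
  moreover have "coeff (\<Sum>i\<le>Suc n. smult (c i) (hilbert_poly i)) (Suc n) = 0"
    using Suc.prems(1) by simp
  ultimately have top: "c (Suc n) = 0" using nz by simp
  then have "(\<Sum>i\<le>n. smult (c i) (hilbert_poly i)) = 0" using Suc.prems(1) by simp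
  then show ?case using Suc.IH Suc.prems(2) top le_Suc_eq by blast
qed

lemma antidifference_exists:
  fixes p :: "'a::field_char_0 poly"
  shows "\<exists>q. poly q 0 = 0 \<and> pcompose q [:1, 1:] = q + p"
proof -
  obtain c where c: "p = (\<Sum>i\<le>degree p. smult (c i) (hilbert_poly i))"
    using hilbert_span by blast
  define q where "q = (\<Sum>i\<le>degree p. smult (c i) (hilbert_poly (Suc i)))"
  have "poly q 0 = 0" by (simp add: q_def poly_sum poly_hilbert_poly)
  moreover have "pcompose q [:1, 1:] = q + p"
    by (subst c) (simp add: q_def pcompose_sum pcompose_smult hilbert_poly_shift smult_add_right sum.distrib)
  ultimately show ?thesis by blast
qed

lemma antidifference_unique:
  fixes p :: "'a::field_char_0 poly"
  assumes "poly q 0 = 0" "pcompose q [:1, 1:] = q + p"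
    and "poly r 0 = 0" "pcompose r [:1, 1:] = r + p"
  shows "q = r"
proof -
  have step: "poly s (of_nat (Suc m)) = poly s (of_nat m) + poly p (of_nat m)"
    if "pcompose s [:1, 1:] = s + p" for s and m :: nat
    using arg_cong[OF that, of "\<lambda>t. poly t (of_nat m)"] by (simp add: poly_pcompose)
  have "poly q (of_nat m) = poly r (of_nat m)" for m
    by (induction m) (use assms step in \<open>simp_all del: of_nat_Suc\<close>)
  then have "range of_nat \<subseteq> {x. poly (q - r) x = 0}" by auto
  moreover have "infinite (range (of_nat :: nat \<Rightarrow> 'a))"
    using finite_imageD inj_of_nat infinite_UNIV_nat by blast
  ultimately have "q - r = 0" using poly_roots_finite finite_subset by blast
  then show ?thesis by simp
qed

fun ncp_rec :: "nat \<Rightarrow> 'a::field_char_0 poly" where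
  "ncp_rec 0 = 1"
| "ncp_rec (Suc k) = (SOME q. poly q 0 = 0 \<and>
     pcompose q [:1, 1:] = q + (\<Sum>i\<le>k. ncp_rec i * ncp_rec (k - i)))"

theorem ex1_ncp_sequence: "\<exists>!P :: nat \<Rightarrow> 'a::field_char_0 poly. is_ncp_sequence P"
proof (rule ex1I)
  have shift: "(\<Sum>i=1..Suc k. f (i - 1) (Suc k - i)) = (\<Sum>i\<le>k. f i (k - i))"
    for f :: "nat \<Rightarrow> nat \<Rightarrow> 'a poly" and k
    by (rule sum.reindex_bij_witness[of _ Suc "\<lambda>i. i - 1"]) auto
  show "is_ncp_sequence (ncp_rec :: nat \<Rightarrow> 'a poly)"
    unfolding is_ncp_sequence_def
  proof (intro conjI[OF ncp_rec.simps(1)] allI impI)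
    fix k :: nat assume "1 \<le> k"
    then obtain m where k: "k = Suc m" by (cases k) auto
    show "poly (ncp_rec k :: 'a poly) 0 = 0 \<and> pcompose (ncp_rec k) [:1, 1:]
        = ncp_rec k + (\<Sum>i=1..k. ncp_rec (i - 1) * (ncp_rec (k - i) :: 'a poly))"
      unfolding k shift[of "\<lambda>i j. ncp_rec i * ncp_rec j"] ncp_rec.simps(2)
      by (rule someI_ex, rule antidifference_exists)
  qed
  fix P :: "nat \<Rightarrow> 'a poly" assume P: "is_ncp_sequence P"
  have R: "is_ncp_sequence (ncp_rec :: nat \<Rightarrow> 'a poly)" by fact
  show "P = ncp_rec"
  proof
    fix k show "P k = ncp_rec k"
    proof (induction k rule: less_induct)
      case (less k)
      show ?case
      proof (cases "k = 0")
        case True then show ?thesis using P by (simp add: is_ncp_sequence_def)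
      next
        case False
        then have eq: "(\<Sum>i=1..k. P (i - 1) * P (k - i)) = (\<Sum>i=1..k. ncp_rec (i - 1) * ncp_rec (k - i))"
          using less by (intro sum.cong) auto
        have k: "k \<ge> 1" using False by simp
        note Pk = P[unfolded is_ncp_sequence_def, THEN conjunct2, rule_format, OF k]
        note Rk = R[unfolded is_ncp_sequence_def, THEN conjunct2, rule_format, OF k]
        show ?thesis
          by (rule antidifference_unique[OF conjunct1[OF Pk] conjunct2[OF Pk, unfolded eq]
                conjunct1[OF Rk] conjunct2[OF Rk]])
      qed
    qed
  qed
qed

corollary is_ncp_sequence_ncp_poly: "is_ncp_sequence ncp_poly"
  unfolding ncp_poly_def using theI'[OF ex1_ncp_sequence] .

theorem ex_hilbert_expansion_ncp_poly:
  assumes "n \<ge> 1"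
  shows "\<exists>c. hilbert_expansion (ncp_poly n :: 'a::field_char_0 poly) c"
proof -
  let ?p = "ncp_poly n :: 'a poly"
  obtain c where c: "?p = (\<Sum>i\<le>degree ?p. smult (c i) (hilbert_poly i))"
    using hilbert_span by blast
  have 0: "poly ?p 0 = 0"
    using is_ncp_sequence_ncp_poly assms unfolding is_ncp_sequence_def by blast
  have "poly ?p 0 = (\<Sum>i\<le>degree ?p. c i * (0 gchoose i))"
    by (subst c) (simp add: poly_sum poly_hilbert_poly)
  also have "\<dots> = c 0" by (subst sum.atMost_shift) simp
  finally have c0: "c 0 = 0" using 0 by simp
  define d where "d i = (if i \<le> degree ?p then c i else 0)" for i
  have "hilbert_expansion ?p d"
    unfolding hilbert_expansion_def
  proof
    show "finite {i. 1 \<le> i \<and> d i \<noteq> 0}"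
      by (rule finite_subset[of _ "{..degree ?p}"]) (auto simp: d_def)
    have "(\<Sum>i | 1 \<le> i \<and> d i \<noteq> 0. smult (d i) (hilbert_poly i))
        = (\<Sum>i\<le>degree ?p. smult (c i) (hilbert_poly i))"
      by (rule sum.mono_neutral_cong_left) (auto simp: d_def c0 Suc_le_eq intro: gr0I split: if_splits)
    with c show "?p = (\<Sum>i | 1 \<le> i \<and> d i \<noteq> 0. smult (d i) (hilbert_poly i))" by simp
  qed
  then show ?thesis by blast
qed

theorem hilbert_expansion_unique:
  fixes p :: "'a::field_char_0 poly"
  assumes c: "hilbert_expansion p c" and d: "hilbert_expansion p d" and i: "i \<ge> 1"
  shows "c i = d i"
proof -
  have "finite ({i. 1 \<le> i \<and> c i \<noteq> 0} \<union> {i. 1 \<le> i \<and> d i \<noteq> 0} \<union> {i})"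
    using c d by (simp add: hilbert_expansion_def)
  then obtain N where N: "\<And>j. j \<in> {i. 1 \<le> i \<and> c i \<noteq> 0} \<union> {i. 1 \<le> i \<and> d i \<noteq> 0} \<union> {i} \<Longrightarrow> j \<le> N"
    using finite_nat_set_iff_bounded_le by metis
  have ext: "p = (\<Sum>j\<le>N. smult (if j = 0 then 0 else e j) (hilbert_poly j))"
    if "hilbert_expansion p e" "\<And>j. 1 \<le> j \<Longrightarrow> e j \<noteq> 0 \<Longrightarrow> j \<le> N" for e
  proof -
    have "p = (\<Sum>j | 1 \<le> j \<and> e j \<noteq> 0. smult (e j) (hilbert_poly j))"
      using that(1) by (simp add: hilbert_expansion_def)
    also have "\<dots> = (\<Sum>j\<le>N. smult (if j = 0 then 0 else e j) (hilbert_poly j))"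
      by (rule sum.mono_neutral_cong_left) (use that(2) in auto)
    finally show ?thesis .
  qed
  have "(\<Sum>j\<le>N. smult ((if j = 0 then 0 else c j) - (if j = 0 then 0 else d j)) (hilbert_poly j)) = p - p"
    unfolding smult_diff_left sum_subtractf
    using ext[OF c] ext[OF d] N by (simp add: Un_iff)
  then have "(if i = 0 then 0 else c i) - (if i = 0 then 0 else d i) = 0"
    using N[of i] by (intro hilbert_independent[of _ N]) auto
  then show ?thesis using i by simp
qed

end

theory Submission
  imports Defs "HOL-Computational_Algebra.Formal_Power_Series"
begin

text \<open>
  Let \<open>F\<^sub>N(t) = \<Sum>\<^sub>n P\<^sub>n(N) t\<^sup>n\<close>. The defining recursion of the \<open>P\<^sub>n\<close> says \<open>F\<^sub>0 = 1\<close> and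
  \<open>F\<^sub>N\<^sub>+\<^sub>1 = F\<^sub>N + t F\<^sub>N\<^sup>2\<close>, which in terms of colourings cuts a word at the letter of
  the smallest colour, if there is one (two such letters would need a smaller colour between
  them). Cutting out the letters of the largest colour instead
  (no two of them are adjacent, so \<open>k\<close> of them are put back into \<open>k\<close> of the
  \<open>n - k + 1\<close> gaps of a word of length \<open>n - k\<close>) suggests
  \<open>F\<^sub>N\<^sub>+\<^sub>1(t) = (1 + t) F\<^sub>N(t + t\<^sup>2)\<close>. No colourings are needed to prove this second
  recursion: substitution of \<open>t + t\<^sup>2 = t (1 + t)\<close> turns the factor \<open>t\<close> of the first
  recursion into \<open>t (1 + t)\<close>, which is exactly what makes \<open>F \<mapsto> (1 + t) F(t + t\<^sup>2)\<close> commute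
  with \<open>F \<mapsto> F + t F\<^sup>2\<close>. Both maps send \<open>F\<^sub>0 = 1\<close> to \<open>1 + t\<close>, so an induction on \<open>N\<close>
  gives the claim (\<open>ncp_series_Suc_compose\<close>).

  Comparing coefficients, at all natural numbers \<open>N\<close> and hence as polynomials,
  \<open>P\<^sub>n(X + 1) = \<Sum>\<^sub>k (n - k + 1 choose k) P\<^sub>n\<^sub>-\<^sub>k(X)\<close> (\<open>ncp_poly_shift\<close>). The term for
  \<open>k = 0\<close> is \<open>P\<^sub>n\<close>, so the remaining terms give the forward difference of \<open>P\<^sub>n\<close>. Since the
  forward difference lowers the index of a Hilbert polynomial by one, the coefficient of
  \<open>H\<^sub>i\<^sub>-\<^sub>1\<close> on the left is \<open>a\<^sub>i\<^sub>,\<^sub>n\<close>, and the recursion is read off on the right. For \<open>i = 1\<close>,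
  \<open>a\<^sub>1\<^sub>,\<^sub>n = P\<^sub>n(1) - P\<^sub>n(0)\<close> is the \<open>n\<close>-th coefficient of \<open>F\<^sub>1 = 1 + t\<close>.
\<close>

section \<open>Hilbert coefficients as iterated differences\<close>

definition forward_diff :: "'a::field_char_0 poly \<Rightarrow> 'a poly" where
  "forward_diff p = pcompose p [:1, 1:] - p"

text \<open>
  Newton's forward difference formula as a definition: it makes the coefficient of \<open>H\<^sub>i\<close> a linear
  functional on all polynomials, so that an identity between polynomials can be compared
  coefficientwise without a common bound on their expansions.
\<close>

definition hilbert_coeff :: "nat \<Rightarrow> 'a::field_char_0 poly \<Rightarrow> 'a" where
  "hilbert_coeff i p = poly ((forward_diff ^^ i) p) 0"

lemma forward_diff_0 [simp]: "forward_diff 0 = 0"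
  by (simp add: forward_diff_def)

lemma forward_diff_add: "forward_diff (p + q) = forward_diff p + forward_diff q"
  by (simp add: forward_diff_def pcompose_add)

lemma forward_diff_smult: "forward_diff (smult c p) = smult c (forward_diff p)"
  by (simp add: forward_diff_def pcompose_smult smult_diff_right)

lemma forward_diff_hilbert_poly:
  "forward_diff (hilbert_poly i) = (if i = 0 then 0 else hilbert_poly (i - 1))"
  by (cases i) (simp_all add: forward_diff_def hilbert_poly_0 hilbert_poly_shift pcompose_1)

lemma hilbert_coeff_Suc: "hilbert_coeff (Suc i) p = hilbert_coeff i (forward_diff p)"
  by (simp add: hilbert_coeff_def funpow_swap1)

lemma hilbert_coeff_0 [simp]: "hilbert_coeff i 0 = 0"
  by (induction i) (simp_all add: hilbert_coeff_Suc, simp add: hilbert_coeff_def)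

lemma hilbert_coeff_add: "hilbert_coeff i (p + q) = hilbert_coeff i p + hilbert_coeff i q"
  by (induction i arbitrary: p q)
    (simp_all add: hilbert_coeff_Suc forward_diff_add, simp add: hilbert_coeff_def)

lemma hilbert_coeff_smult: "hilbert_coeff i (smult c p) = c * hilbert_coeff i p"
  by (induction i arbitrary: p)
    (simp_all add: hilbert_coeff_Suc forward_diff_smult, simp add: hilbert_coeff_def)

lemma hilbert_coeff_sum: "hilbert_coeff i (\<Sum>x\<in>A. f x) = (\<Sum>x\<in>A. hilbert_coeff i (f x))"
  by (induction A rule: infinite_finite_induct) (simp_all add: hilbert_coeff_add)

lemma hilbert_coeff_hilbert_poly: "hilbert_coeff i (hilbert_poly j) = (if i = j then 1 else 0)"
proof (induction i arbitrary: j)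
  case 0
  show ?case by (cases j) (simp_all add: hilbert_coeff_def poly_hilbert_poly)
next
  case (Suc i)
  then show ?case by (cases j) (simp_all add: hilbert_coeff_Suc forward_diff_hilbert_poly)
qed

lemma hilbert_expansion_imp_coeff:
  assumes "hilbert_expansion p c" and "i \<ge> 1"
  shows "c i = hilbert_coeff i p"
proof -
  let ?S = "{j. 1 \<le> j \<and> c j \<noteq> 0}"
  have fin: "finite ?S" and p: "p = (\<Sum>j\<in>?S. smult (c j) (hilbert_poly j))"
    using assms(1) by (simp_all add: hilbert_expansion_def)
  have "hilbert_coeff i p = (\<Sum>j\<in>?S. if i = j then c j else 0)"
    by (subst p, unfold hilbert_coeff_sum)
      (rule sum.cong, simp_all add: hilbert_coeff_smult hilbert_coeff_hilbert_poly)
  then show ?thesis using fin assms(2) by simp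
qed

section \<open>Two recursions for the generating series\<close>

unbundle fps_syntax

definition ncp_series :: "nat \<Rightarrow> 'a::field_char_0 fps" where
  "ncp_series N = Abs_fps (\<lambda>n. poly (ncp_poly n) (of_nat N))"

lemma ncp_series_nth: "ncp_series N $ n = poly (ncp_poly n) (of_nat N)"
  by (simp add: ncp_series_def)

lemma ncp_poly_0: "ncp_poly 0 = 1"
  using is_ncp_sequence_ncp_poly unfolding is_ncp_sequence_def by blast

lemma poly_ncp_poly_0: "n \<ge> 1 \<Longrightarrow> poly (ncp_poly n) 0 = 0"
  using is_ncp_sequence_ncp_poly unfolding is_ncp_sequence_def by blast

lemma pcompose_ncp_poly_Suc:
  "pcompose (ncp_poly (Suc n)) [:1, 1:]
    = ncp_poly (Suc n) + (\<Sum>i\<le>n. ncp_poly i * ncp_poly (n - i))"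
proof -
  have "pcompose (ncp_poly (Suc n)) [:1, 1:]
      = ncp_poly (Suc n) + (\<Sum>i=1..Suc n. ncp_poly (i - 1) * (ncp_poly (Suc n - i) :: 'a poly))"
    using is_ncp_sequence_ncp_poly[where 'a='a] unfolding is_ncp_sequence_def by simp
  also have "(\<Sum>i=1..Suc n. ncp_poly (i - 1) * (ncp_poly (Suc n - i) :: 'a poly))
      = (\<Sum>i\<le>n. ncp_poly i * ncp_poly (n - i))"
    by (rule sum.reindex_bij_witness[of _ Suc "\<lambda>i. i - 1"]) auto
  finally show ?thesis .
qed

lemma ncp_series_0: "ncp_series 0 = 1"
  by (rule fps_ext) (simp add: ncp_series_nth ncp_poly_0 poly_ncp_poly_0 Suc_le_eq)

lemma ncp_series_Suc: "ncp_series (Suc N) = ncp_series N + fps_X * ncp_series N ^ 2"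
proof (rule fps_ext)
  fix n
  show "ncp_series (Suc N) $ n = (ncp_series N + fps_X * ncp_series N ^ 2 :: 'a fps) $ n"
  proof (cases n)
    case 0
    then show ?thesis by (simp add: ncp_series_nth ncp_poly_0)
  next
    case (Suc m)
    have "(ncp_series N ^ 2 :: 'a fps) $ m
        = (\<Sum>i\<le>m. poly (ncp_poly i) (of_nat N) * poly (ncp_poly (m - i)) (of_nat N))"
      by (simp add: power2_eq_square fps_mult_nth ncp_series_nth atLeast0AtMost)
    then show ?thesis
      using arg_cong[OF pcompose_ncp_poly_Suc[of m], of "\<lambda>p. poly p (of_nat N :: 'a)"]
      by (simp add: Suc ncp_series_nth poly_pcompose poly_sum)
  qed
qed

text \<open>
  The induction works because, with \<open>s = t + t\<^sup>2\<close> and \<open>G = F(s)\<close>,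
  \<open>(1 + t) G + t ((1 + t) G)\<^sup>2 = (1 + t) (G + s G\<^sup>2)\<close>.
\<close>

lemma ncp_series_Suc_compose:
  "ncp_series (Suc N) = (1 + fps_X) * (ncp_series N oo (fps_X + fps_X ^ 2))"
proof (induction N)
  case 0
  show ?case by (simp add: ncp_series_Suc ncp_series_0)
next
  case (Suc N)
  let ?s = "fps_X + fps_X ^ 2 :: 'a fps"
  let ?G = "ncp_series N oo ?s :: 'a fps"
  have "ncp_series (Suc N) oo ?s = ?G + ?s * ?G ^ 2"
    by (simp add: ncp_series_Suc fps_compose_add_distrib fps_compose_mult_distrib fps_compose_power)
  moreover have "ncp_series (Suc (Suc N)) = (1 + fps_X) * (?G + ?s * ?G ^ 2)"
    unfolding ncp_series_Suc[of "Suc N"] Suc by (simp add: algebra_simps power2_eq_square)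
  ultimately show ?case by simp
qed

section \<open>The binomial recursion for the polynomials\<close>

lemma fps_X_plus_X2_power_nth:
  "((fps_X + fps_X ^ 2) ^ m :: 'a::field_char_0 fps) $ n
    = (if n < m then 0 else of_nat (m choose (n - m)))"
proof -
  have "(fps_X + fps_X ^ 2 :: 'a fps) ^ m = fps_X ^ m * (1 + fps_X) ^ m"
    by (simp add: power_mult_distrib[symmetric] algebra_simps power2_eq_square)
  then show ?thesis
    by (simp add: fps_X_power_mult_nth fps_binomial_power
        flip: fps_binomial_of_nat add: binomial_gbinomial)
qed

lemma one_plus_X_mult_compose_nth:
  fixes F :: "'a::field_char_0 fps"
  shows "((1 + fps_X) * (F oo (fps_X + fps_X ^ 2))) $ n
    = (\<Sum>m\<le>n. of_nat (Suc m choose (n - m)) * F $ m)"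
proof (cases n)
  case 0
  then show ?thesis by simp
next
  case (Suc l)
  have G: "(F oo (fps_X + fps_X ^ 2)) $ q = (\<Sum>m\<le>q. of_nat (m choose (q - m)) * F $ m)" for q
    by (simp add: fps_compose_nth fps_X_plus_X2_power_nth atLeast0AtMost mult.commute)
  have "((1 + fps_X) * (F oo (fps_X + fps_X ^ 2))) $ n
      = (\<Sum>m\<le>Suc l. of_nat (m choose (Suc l - m)) * F $ m)
        + (\<Sum>m\<le>l. of_nat (m choose (l - m)) * F $ m)"
    by (simp add: Suc distrib_right G)
  also have "\<dots> = F $ Suc l + (\<Sum>m\<le>l. of_nat (Suc m choose (Suc l - m)) * F $ m)"
    by (simp add: sum.distrib[symmetric] Suc_diff_le algebra_simps)
  also have "\<dots> = (\<Sum>m\<le>n. of_nat (Suc m choose (n - m)) * F $ m)"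
    by (simp add: Suc)
  finally show ?thesis .
qed

lemma poly_eqI_of_nat:
  fixes p q :: "'a::field_char_0 poly"
  assumes "\<And>N. poly p (of_nat N) = poly q (of_nat N)"
  shows "p = q"
proof -
  have "range of_nat \<subseteq> {x. poly (p - q) x = 0}" using assms by auto
  moreover have "infinite (range (of_nat :: nat \<Rightarrow> 'a))"
    using finite_imageD inj_of_nat infinite_UNIV_nat by blast
  ultimately have "p - q = 0" using poly_roots_finite finite_subset by blast
  then show ?thesis by simp
qed

lemma ncp_poly_shift:
  "pcompose (ncp_poly n) [:1, 1:] = (\<Sum>m\<le>n. smult (of_nat (Suc m choose (n - m))) (ncp_poly m))"
proof (rule poly_eqI_of_nat)
  fix N
  show "poly (pcompose (ncp_poly n) [:1, 1:]) (of_nat N :: 'a)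
      = poly (\<Sum>m\<le>n. smult (of_nat (Suc m choose (n - m))) (ncp_poly m)) (of_nat N)"
    using arg_cong[OF ncp_series_Suc_compose[of N], of "\<lambda>F. F $ n :: 'a"]
    by (simp only: one_plus_X_mult_compose_nth)
      (simp add: ncp_series_nth poly_pcompose poly_sum)
qed

text \<open>
  In this form every \<open>ncp_poly\<close> on the right has positive index as soon as \<open>n \<ge> 2\<close>: the
  binomial coefficient vanishes unless \<open>2 * k \<le> n + 1\<close>.
\<close>

lemma forward_diff_ncp_poly:
  "forward_diff (ncp_poly n)
    = (\<Sum>k = 1..(n + 1) div 2. smult (of_nat ((n - k + 1) choose k)) (ncp_poly (n - k)))"
proof -
  let ?f = "\<lambda>k. smult (of_nat ((n - k + 1) choose k)) (ncp_poly (n - k)) :: 'a poly"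
  have "pcompose (ncp_poly n) [:1, 1:] = (\<Sum>k\<le>n. ?f k)"
    unfolding ncp_poly_shift
    by (rule sum.reindex_bij_witness[of _ "\<lambda>k. n - k" "\<lambda>k. n - k"]) auto
  also have "\<dots> = ncp_poly n + (\<Sum>k = 1..n. ?f k)"
    by (simp add: atMost_atLeast0 sum.atLeast_Suc_atMost)
  also have "(\<Sum>k = 1..n. ?f k) = (\<Sum>k = 1..(n + 1) div 2. ?f k)"
    by (rule sum.mono_neutral_right) (auto simp: binomial_eq_0)
  finally show ?thesis by (simp add: forward_diff_def)
qed

section \<open>The recursion for the Hilbert coefficients\<close>

theorem proposition3p8:
  fixes a :: "nat \<Rightarrow> nat \<Rightarrow> 'a::field_char_0"
    and i n :: nat
  assumes expansion: "\<And>m. m \<ge> 1 \<Longrightarrow> hilbert_expansion (ncp_poly m) (\<lambda>j. a j m)"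
    and "1 \<le> i" and "i \<le> n"
  shows "a i n =
    (if i = 1 then (if n = 1 then 1 else 0)
     else (\<Sum>k = 1..(n + 1) div 2. of_nat ((n - k + 1) choose k) * a (i - 1) (n - k)))"
proof (cases "i = 1")
  case True
  have "a 1 n = hilbert_coeff 1 (ncp_poly n)"
    using hilbert_expansion_imp_coeff[OF expansion] assms by simp
  also have "\<dots> = poly (ncp_poly n) 1"
    using assms by (simp add: hilbert_coeff_def forward_diff_def poly_pcompose poly_ncp_poly_0)
  also have "\<dots> = ncp_series (Suc 0) $ n"
    by (simp add: ncp_series_nth)
  also have "\<dots> = (if n = 1 then 1 else 0)"
    using assms by (simp add: ncp_series_Suc ncp_series_0)
  finally show ?thesis using True by simp
next
  case False
  then obtain j where i: "i = Suc j" and j: "j \<ge> 1" using assms by (cases i) auto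
  have "a i n = hilbert_coeff j (forward_diff (ncp_poly n))"
    using hilbert_expansion_imp_coeff[OF expansion] assms by (simp add: i hilbert_coeff_Suc)
  also have "\<dots> = (\<Sum>k = 1..(n + 1) div 2.
      of_nat ((n - k + 1) choose k) * hilbert_coeff j (ncp_poly (n - k)))"
    by (simp only: forward_diff_ncp_poly hilbert_coeff_sum hilbert_coeff_smult)
  also have "\<dots> = (\<Sum>k = 1..(n + 1) div 2. of_nat ((n - k + 1) choose k) * a j (n - k))"
  proof (rule sum.cong)
    fix k assume "k \<in> {1..(n + 1) div 2}"
    moreover have "n \<ge> 2" using assms i j by simp
    ultimately have "n - k \<ge> 1" by auto
    then show "of_nat ((n - k + 1) choose k) * hilbert_coeff j (ncp_poly (n - k))
        = of_nat ((n - k + 1) choose k) * a j (n - k)"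
      using hilbert_expansion_imp_coeff[OF expansion j] by simp
  qed simp
  finally show ?thesis using False by (simp add: i)
qed

end
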